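(* Let $(X,\mathcal{B},\mu,T)$ be an ergodic measure-preserving dynamical system on a non-atomic probability space ($\mu(X)=1$). For each $1<p<\infty$ there exists a finite constant $C_p$ such that for all measurable functions $f\ge 0$ with $f\in L^p(\mu)$, all measurable $g\ge 0$ with $g\in L^1(\mu)$, and all $\lambda>0$, $$\mu\Big\{x\in X:\ \sup_{n\ge 1}\frac{f(T^nx)\,g(T^{2n}x)}{n}>\lambda\Big\}\le C_p\left(\frac{\|f\|_p\,\|g\|_1}{\lambda}\right)^{1/2}.$$ Moreover, there exists a finite constant $\widetilde C$ such that $C_p\le \dfrac{\widetilde C}{p-1}$ for all $1<p<2$.
   Context: $T:X\to X$ is an invertible-or-not measurable map preserving $\mu$ and ergodic; $\|\cdot\|_p$ denotes the $L^p(\mu)$ norm. The constants $C_p$ and $\widetilde C$ do not depend on $f$, $g$ or $\lambda$. *)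

theory Defs
  imports "HOL-Probability.Probability"
begin

definition mpt :: "'a measure \<Rightarrow> ('a \<Rightarrow> 'a) \<Rightarrow> bool" where
  "mpt M T \<longleftrightarrow> T \<in> measurable M M \<and>
     (\<forall>A \<in> sets M. emeasure M (T -` A \<inter> space M) = emeasure M A)"

definition ergodic :: "'a measure \<Rightarrow> ('a \<Rightarrow> 'a) \<Rightarrow> bool" where
  "ergodic M T \<longleftrightarrow> mpt M T \<and>
     (\<forall>A \<in> sets M. T -` A \<inter> space M = A \<longrightarrow>
        emeasure M A = 0 \<or> emeasure M A = emeasure M (space M))"

definition nonatomic :: "'a measure \<Rightarrow> bool" where
  "nonatomic M \<longleftrightarrow> (\<forall>A \<in> sets M. emeasure M A > 0 \<longrightarrow>
     (\<exists>B \<in> sets M. B \<subseteq> A \<and> 0 < emeasure M B \<and> emeasure M B < emeasure M A))"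

definition Lp_norm :: "'a measure \<Rightarrow> real \<Rightarrow> ('a \<Rightarrow> real) \<Rightarrow> real" where
  "Lp_norm M p f = (\<integral>x. \<bar>f x\<bar> powr p \<partial>M) powr (1 / p)"

definition in_Lp :: "'a measure \<Rightarrow> real \<Rightarrow> ('a \<Rightarrow> real) \<Rightarrow> bool" where
  "in_Lp M p f \<longleftrightarrow> f \<in> borel_measurable M \<and> integrable M (\<lambda>x. \<bar>f x\<bar> powr p)"

end

theory Submission
  imports Defs
begin

text \<open>
  By homogeneity both norms may be taken to be 1 and the level to be \<open>l \<ge> 1\<close>. Put \<open>t = sqrt l\<close>.
  Along an orbit segment, write \<open>F\<close> and \<open>G\<close> for the values of \<open>f\<close> and \<open>g\<close>. The indices \<open>j\<close>
  from which some forward average of \<open>F powr p\<close> exceeds \<open>t\<close> have density at most \<open>1 / t\<close>. If \<open>j\<close> is any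
  other bad index, with \<open>F (j + n) * G (j + 2 * n) > l * n\<close>, fix the end point \<open>b = j + 2 * n\<close> and put
  \<open>c = G b / l\<close>: then \<open>F (b - n) > n / c\<close>, while \<open>F powr p\<close> has average at most \<open>2 * t\<close> over the
  \<open>n\<close> places before \<open>b\<close>. By Chebyshev's inequality on the blocks \<open>2 ^ k * c < n \<le> 2 ^ Suc k * c\<close>
  there are \<open>O(c * t / (1 - 2 powr (1 - p)))\<close> such \<open>n\<close>, and the sum over \<open>b\<close> has density \<open>O(t / l) = O(1 / t)\<close>.
\<close>

section \<open>Counting estimates for sequences on a finite segment\<close>

text \<open>Greedy covering from the left: when \<open>a\<close> is counted with a witness
  \<open>m\<close>, the window of length \<open>m\<close> at \<open>a\<close> holds at most
  \<open>m\<close> counted indices and its sum exceeds \<open>t * m\<close>, so it pays for all of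
  them; the scan resumes at \<open>a + m\<close>. Windows start before \<open>N\<close> and have
  length at most \<open>R\<close>, hence the range up to \<open>N + R\<close>.\<close>

lemma card_forward_average_gt_le:
  fixes v :: "nat \<Rightarrow> real" and t :: real
  assumes nn: "\<And>i. v i \<ge> 0" and t: "t > 0"
  shows "t * card {j\<in>{a..<N}. \<exists>m\<in>{1..R}. (\<Sum>i<m. v (j + i)) > t * m} \<le> (\<Sum>i\<in>{a..<N+R}. v i)"
proof (induction "N - a" arbitrary: a rule: less_induct)
  case less
  define E where "E a = {j\<in>{a..<N}. \<exists>m\<in>{1..R}. (\<Sum>i<m. v (j + i)) > t * m}" for a
  have IH: "t * card (E a') \<le> (\<Sum>i\<in>{a'..<N+R}. v i)" if "a < a'" "a < N" for a'
    using less[of a'] that unfolding E_def by auto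
  consider "a \<ge> N" | "a < N" "a \<notin> E a" | "a < N" "a \<in> E a" by linarith
  then have "t * card (E a) \<le> (\<Sum>i\<in>{a..<N+R}. v i)"
  proof cases
    case 1
    then have "E a = {}" by (auto simp: E_def)
    then show ?thesis by (simp add: sum_nonneg nn)
  next
    case 2
    have "j \<in> E (Suc a)" if "j \<in> E a" for j
    proof -
      have "j \<noteq> a" using that 2 by auto
      then show ?thesis using that by (auto simp: E_def)
    qed
    then have "E a = E (Suc a)" by (auto simp: E_def)
    then have "t * card (E a) \<le> (\<Sum>i\<in>{Suc a..<N+R}. v i)" using IH[of "Suc a"] 2 by simp
    also have "\<dots> \<le> (\<Sum>i\<in>{a..<N+R}. v i)"
      by (rule sum_mono2) (auto simp: nn)
    finally show ?thesis .
  next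
    case 3
    then obtain m where m: "m \<in> {1..R}" "(\<Sum>i<m. v (a + i)) > t * m"
      by (auto simp: E_def)
    have fin: "finite (E b)" for b by (simp add: E_def)
    have "E a \<subseteq> {a..<a+m} \<union> E (a + m)" by (auto simp: E_def)
    then have "card (E a) \<le> card ({a..<a+m} \<union> E (a + m))" by (intro card_mono) (auto simp: fin)
    also have "\<dots> \<le> m + card (E (a + m))" using card_Un_le[of "{a..<a+m}" "E (a+m)"] by simp
    finally have "card (E a) \<le> m + card (E (a + m))" .
    then have "t * card (E a) \<le> t * (m + card (E (a + m)))"
      using t by simp
    moreover have "t * card (E (a + m)) \<le> (\<Sum>i\<in>{a+m..<N+R}. v i)"
      using IH[of "a+m"] m 3 by auto
    moreover have "(\<Sum>i<m. v (a + i)) = (\<Sum>i\<in>{a..<a+m}. v i)"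
      by (rule sum.reindex_bij_witness[of _ "\<lambda>i. i - a" "\<lambda>i. a + i"]) auto
    moreover have "(\<Sum>i\<in>{a..<a+m}. v i) + (\<Sum>i\<in>{a+m..<N+R}. v i) = (\<Sum>i\<in>{a..<N+R}. v i)"
      using m 3 by (intro sum.atLeastLessThan_concat) auto
    ultimately show ?thesis using m(2) by (simp add: distrib_left)
  qed
  then show ?case by (simp add: E_def)
qed

text \<open>At most \<open>c\<close> indices satisfy \<open>n \<le> c\<close>. On the dyadic block
  \<open>B k\<close> each \<open>u n\<close> exceeds \<open>2 ^ k\<close>, and Chebyshev's
  inequality bounds its size by a multiple of \<open>r ^ k\<close> with
  \<open>r = 2 powr (1 - p)\<close>. Since \<open>p > 1\<close>, the geometric series converges, and
  this produces the factor \<open>1 / (1 - r)\<close>.\<close>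

lemma card_large_values_le:
  fixes u :: "nat \<Rightarrow> real" and c t p :: real
  assumes nn: "\<And>i. u i \<ge> 0" and c: "c \<ge> 0" and t: "t \<ge> 0" and p: "p > 1"
    and S: "finite S"
    and S1: "\<And>n. n \<in> S \<Longrightarrow> n \<ge> 1"
    and S2: "\<And>n. n \<in> S \<Longrightarrow> c * u n > n"
    and S3: "\<And>n. n \<in> S \<Longrightarrow> (\<Sum>i=1..n. u i powr p) \<le> 2 * t * n"
  shows "card S \<le> c * (1 + 4 * t / (1 - 2 powr (1 - p)))"
\<comment> \<open>The blocks scale with \<open>c\<close>, so the degenerate value, which occurs
  where \<open>G\<close> vanishes, is split off.\<close>
proof (cases "c = 0")
  case True
  then have "S = {}" using S2 by fastforce
  then show ?thesis using True by simp
next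
  case False
  with c have c: "c > 0" by simp
  define r where "r = 2 powr (1 - p)"
  have r: "0 < r" "r < 1"
    using p powr_less_mono[of "1 - p" 0 "2::real"] by (auto simp: r_def)
  define B where "B k = {n\<in>S. 2 ^ k * c < n \<and> n \<le> 2 ^ Suc k * c}" for k :: nat
  have finB: "finite (B k)" for k using S by (simp add: B_def)
  have cardB: "card (B k) \<le> 4 * t * c * r ^ k" for k
  proof (cases "B k = {}")
    case True
    then show ?thesis using r t c by simp
  next
    case ne: False
    \<comment> \<open>The average bound at the largest index of the block suffices: the block lies
      in \<open>{1..m}\<close>, and \<open>m \<le> 2 ^ Suc k * c\<close>.\<close>
    define m where "m = Max (B k)"
    have m: "m \<in> B k" using ne finB Max_in by (auto simp: m_def)
    have "card (B k) * (2 ^ k) powr p = (\<Sum>n\<in>B k. (2 ^ k) powr p)" by simp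
    also have "\<dots> \<le> (\<Sum>n\<in>B k. u n powr p)"
    proof (rule sum_mono)
      fix n assume "n \<in> B k"
      then have "2 ^ k * c < c * u n" using S2[of n] by (auto simp: B_def)
      then have "2 ^ k \<le> u n" using c by (simp add: mult.commute)
      then show "(2 ^ k) powr p \<le> u n powr p" using p by (intro powr_mono2) auto
    qed
    also have "\<dots> \<le> (\<Sum>i=1..m. u i powr p)"
    proof (rule sum_mono2)
      show "B k \<subseteq> {1..m}" using S1 finB by (auto simp: m_def B_def intro!: Max_ge)
    qed auto
    also have "\<dots> \<le> 2 * t * m" using m S3 by (auto simp: B_def)
    also have "\<dots> \<le> 2 * t * (2 ^ Suc k * c)"
      using m t by (intro mult_left_mono) (auto simp: B_def)
    finally have le: "card (B k) * (2 ^ k) powr p \<le> 4 * t * c * 2 ^ k" by (simp add: mult_ac)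
    have "r ^ k * (2 ^ k) powr p = 2 powr (k * (1 - p)) * 2 powr (k * p)"
      by (simp add: r_def powr_realpow [symmetric] powr_powr mult.commute)
    also have "\<dots> = 2 ^ k"
      by (simp add: powr_add [symmetric] algebra_simps powr_realpow)
    finally have "card (B k) * (2 ^ k) powr p \<le> (4 * t * c * r ^ k) * (2 ^ k) powr p"
      using le by (simp add: mult.assoc)
    then show ?thesis by (rule mult_right_le_imp_le) simp
  qed
  \<comment> \<open>\<open>K\<close> is chosen so that all of \<open>S\<close> lies below
    \<open>2 ^ K * c\<close> and finitely many blocks cover it; inserting 0 keeps \<open>Max\<close>
    meaningful for empty \<open>S\<close>.\<close>
  obtain K :: nat where K: "real (Max (insert 0 S)) / c < 2 ^ K"
    using real_arch_pow[of 2] by auto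
  have "S \<subseteq> {n. 1 \<le> n \<and> n \<le> nat \<lfloor>c\<rfloor>} \<union> (\<Union>k<K. B k)"
  proof
    fix n assume n: "n \<in> S"
    show "n \<in> {n. 1 \<le> n \<and> n \<le> nat \<lfloor>c\<rfloor>} \<union> (\<Union>k<K. B k)"
    proof (cases "n \<le> c")
      case True
      then show ?thesis using S1[OF n] by (auto simp: le_nat_floor)
    next
      case False
      \<comment> \<open>Minimality gives the lower end of the block for \<open>k > 0\<close>; for
        \<open>k = 0\<close> the lower end is the case assumption \<open>n > c\<close>.\<close>
      define k where "k = (LEAST k. n \<le> 2 ^ Suc k * c)"
      have "n \<le> Max (insert 0 S)" using n S by simp
      then have nK: "n < 2 ^ K * c" using K c by (simp add: field_simps)
      with False have "K \<noteq> 0" by (intro notI) simp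
      then obtain K' where K': "K = Suc K'" by (cases K) auto
      then have K'n: "n \<le> 2 ^ Suc K' * c" using nK by simp
      have k1: "n \<le> 2 ^ Suc k * c" unfolding k_def by (rule LeastI) (rule K'n)
      have k2: "k < K" unfolding k_def using Least_le[of "\<lambda>k. n \<le> 2 ^ Suc k * c", OF K'n] K' by simp
      have "2 ^ k * c < n"
      proof (cases k)
        case 0
        then show ?thesis using False by simp
      next
        case (Suc k')
        then have "k' < (LEAST k. n \<le> 2 ^ Suc k * c)" by (simp add: k_def)
          then have "\<not> n \<le> 2 ^ Suc k' * c" by (rule not_less_Least)
        then show ?thesis using Suc by simp
      qed
      then show ?thesis using k1 k2 n by (auto simp: B_def)
    qed
  qed
  then have "card S \<le> card ({1..nat \<lfloor>c\<rfloor>} \<union> (\<Union>k<K. B k))"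
    by (intro card_mono) (auto simp: finB)
  also have "\<dots> \<le> nat \<lfloor>c\<rfloor> + (\<Sum>k<K. card (B k))"
    using card_Un_le[of "{1..nat \<lfloor>c\<rfloor>}" "\<Union>k<K. B k"] card_UN_le[of "{..<K}" B] by simp
  finally have "real (card S) \<le> nat \<lfloor>c\<rfloor> + (\<Sum>k<K. real (card (B k)))"
    by (simp flip: of_nat_add of_nat_sum)
  also have "\<dots> \<le> c + (\<Sum>k<K. 4 * t * c * r ^ k)"
    using c by (intro add_mono sum_mono cardB) auto
  also have "(\<Sum>k<K. 4 * t * c * r ^ k) = 4 * t * c * (\<Sum>k<K. r ^ k)"
    by (simp add: sum_distrib_left)
  also have "\<dots> \<le> 4 * t * c * (1 / (1 - r))"
  proof (rule mult_left_mono)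
    have "(\<Sum>k<K. r ^ k) = (1 - r ^ K) / (1 - r)" using r by (simp add: sum_gp_strict)
    also have "\<dots> \<le> 1 / (1 - r)" using r by (intro divide_right_mono) auto
    finally show "(\<Sum>k<K. r ^ k) \<le> 1 / (1 - r)" .
  qed (use t c in auto)
  finally show ?thesis by (simp add: r_def algebra_simps)
qed

text \<open>A bad index outside \<open>E\<close> is determined by its end point \<open>b\<close> and
  its time \<open>n\<close> as \<open>b - 2 * n\<close>, so such indices are counted by summing
  \<open>card (S b)\<close> over \<open>b\<close>. All end points lie below
  \<open>N + 2 * R\<close>.\<close>

lemma card_bilinear_gt_le:
  fixes F G :: "nat \<Rightarrow> real" and l t p :: real
  assumes F: "\<And>i. F i \<ge> 0" and G: "\<And>i. G i \<ge> 0" and l: "l > 0" and t: "t > 0" and p: "p > 1"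
  shows "card {j. j < N \<and> (\<exists>n\<in>{1..R}. F (j + n) * G (j + 2 * n) > l * n)}
    \<le> (\<Sum>i<N+2*R. F i powr p) / t + (1 + 4 * t / (1 - 2 powr (1 - p))) / l * (\<Sum>b<N+2*R. G b)"
proof -
  define bad where "bad = {j. j < N \<and> (\<exists>n\<in>{1..R}. F (j + n) * G (j + 2 * n) > l * n)}"
  define E where "E = {j\<in>{0..<N}. \<exists>m\<in>{1..2*R}. (\<Sum>i<m. F (j + i) powr p) > t * m}"
  define S where "S b = {n\<in>{1..R}. 2 * n \<le> b \<and> F (b - n) * G b > l * n \<and>
    (\<Sum>i=1..n. F (b - i) powr p) \<le> 2 * t * n}" for b
  have "bad \<subseteq> E \<union> (\<Union>b<N+2*R. (\<lambda>n. b - 2 * n) ` S b)"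
  proof
    fix j assume "j \<in> bad"
    then obtain n where j: "j < N" and n: "n \<in> {1..R}" and gt: "F (j + n) * G (j + 2 * n) > l * n"
      by (auto simp: bad_def)
    show "j \<in> E \<union> (\<Union>b<N+2*R. (\<lambda>n. b - 2 * n) ` S b)"
    proof (cases "j \<in> E")
      case False
      \<comment> \<open>The \<open>n\<close> places before \<open>j + 2 * n\<close> form the second
        half of the window of length \<open>2 * n\<close> at \<open>j\<close>. As \<open>j\<close>
        is outside \<open>E\<close>, the whole window sums to at most \<open>t * (2 * n)\<close>;
        this is why \<open>E\<close> allows windows up to \<open>2 * R\<close>.\<close>
      have "(\<Sum>i=1..n. F (j + 2 * n - i) powr p) = (\<Sum>i\<in>{n..<2*n}. F (j + i) powr p)"
        by (rule sum.reindex_bij_witness[of _ "\<lambda>i. 2 * n - i" "\<lambda>i. 2 * n - i"]) auto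
      also have "\<dots> \<le> (\<Sum>i<2*n. F (j + i) powr p)" by (rule sum_mono2) auto
      also have "\<dots> \<le> t * (2 * n)"
      proof -
        have "\<not> (\<Sum>i<2*n. F (j + i) powr p) > t * real (2 * n)"
        proof
          assume "(\<Sum>i<2*n. F (j + i) powr p) > t * real (2 * n)"
          moreover have "2 * n \<in> {1..2*R}" using n by auto
          ultimately have "j \<in> E" using j unfolding E_def by fastforce
          with False show False ..
        qed
        then show ?thesis by simp
      qed
      finally have "n \<in> S (j + 2 * n)" using n gt by (simp add: S_def mult_ac add.commute)
      then have "j \<in> (\<lambda>n'. (j + 2 * n) - 2 * n') ` S (j + 2 * n)" by (intro image_eqI) auto
      moreover have "j + 2 * n < N + 2 * R" using j n by auto
      ultimately show ?thesis by blast
    qed simp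
  qed
  then have "card bad \<le> card (E \<union> (\<Union>b<N+2*R. (\<lambda>n. b - 2 * n) ` S b))"
    by (intro card_mono) (auto simp: E_def S_def)
  also have "\<dots> \<le> card E + (\<Sum>b<N+2*R. card ((\<lambda>n. b - 2 * n) ` S b))"
    using card_Un_le[of E "\<Union>b<N+2*R. (\<lambda>n. b - 2 * n) ` S b"]
      card_UN_le[of "{..<N+2*R}" "\<lambda>b. (\<lambda>n. b - 2 * n) ` S b"] by simp
  also have "\<dots> \<le> card E + (\<Sum>b<N+2*R. card (S b))"
    by (intro add_left_mono sum_mono card_image_le) (auto simp: S_def)
  finally have "real (card bad) \<le> card E + (\<Sum>b<N+2*R. real (card (S b)))"
    by (simp flip: of_nat_add of_nat_sum)
  also have "\<dots> \<le> (\<Sum>i<N+2*R. F i powr p) / t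
      + (\<Sum>b<N+2*R. G b / l * (1 + 4 * t / (1 - 2 powr (1 - p))))"
  proof (intro add_mono sum_mono)
    have "t * card E \<le> (\<Sum>i\<in>{0..<N+2*R}. F i powr p)"
      unfolding E_def using card_forward_average_gt_le[of "\<lambda>i. F i powr p" t 0 N "2 * R"] t by simp
    then show "card E \<le> (\<Sum>i<N+2*R. F i powr p) / t"
      using t by (simp add: field_simps atLeast0LessThan)
  next
    fix b
    show "card (S b) \<le> G b / l * (1 + 4 * t / (1 - 2 powr (1 - p)))"
      by (rule card_large_values_le[where u = "\<lambda>i. F (b - i)"])
        (use F G l t p in \<open>auto simp: S_def field_simps\<close>)
  qed
  also have "\<dots> = (\<Sum>i<N+2*R. F i powr p) / t
      + (1 + 4 * t / (1 - 2 powr (1 - p))) / l * (\<Sum>b<N+2*R. G b)"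
    by (simp add: mult.commute flip: sum_distrib_right sum_divide_distrib)
  finally show ?thesis by (simp add: bad_def)
qed

section \<open>Transference from orbit segments to the measure\<close>

lemma mpt_funpow:
  assumes "mpt M T"
  shows "T ^^ n \<in> measurable M M" and "distr M M (T ^^ n) = M"
proof -
  have T: "T \<in> measurable M M" using assms by (simp add: mpt_def)
  have D: "distr M M T = M"
  proof (rule measure_eqI)
    fix A assume "A \<in> sets (distr M M T)"
    then show "emeasure (distr M M T) A = emeasure M A"
      using assms by (simp add: emeasure_distr T mpt_def)
  qed simp
  show n: "T ^^ n \<in> measurable M M" for n
    by (induction n) (auto intro!: measurable_comp[OF _ T, unfolded o_def] simp: o_def)
  show "distr M M (T ^^ n) = M"
  proof (induction n)
    case (Suc n)
    have "distr M M (T ^^ Suc n) = distr (distr M M (T ^^ n)) M T"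
      by (simp add: distr_distr[OF T n] del: Suc)
    then show ?case by (simp only: Suc D)
  qed (simp add: id_def)
qed

lemma mpt_integral_funpow:
  fixes h :: "'a \<Rightarrow> real"
  assumes "mpt M T" and "integrable M h"
  shows "integrable M (\<lambda>x. h ((T ^^ n) x))" and "(\<integral>x. h ((T ^^ n) x) \<partial>M) = (\<integral>x. h x \<partial>M)"
proof -
  note T = mpt_funpow[OF assms(1), of n]
  have h: "h \<in> borel_measurable M" using assms(2) by simp
  show "integrable M (\<lambda>x. h ((T ^^ n) x))"
    by (rule integrable_distr[OF T(1)]) (simp add: T assms)
  show "(\<integral>x. h ((T ^^ n) x) \<partial>M) = (\<integral>x. h x \<partial>M)"
    using integral_distr[OF T(1) h] by (simp add: T(2))
qed

text \<open>The index set is a parameter so that the truncated range \<open>{1..R}\<close> and the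
  full range \<open>{1..}\<close> share one notion; the existential form avoids both supremum and
  division.\<close>

definition bilinear_tail_set ::
  "'a measure \<Rightarrow> ('a \<Rightarrow> 'a) \<Rightarrow> ('a \<Rightarrow> real) \<Rightarrow> ('a \<Rightarrow> real) \<Rightarrow> real \<Rightarrow> nat set \<Rightarrow> 'a set" where
  "bilinear_tail_set M T f g l I = {x\<in>space M. \<exists>n\<in>I. f ((T ^^ n) x) * g ((T ^^ (2 * n)) x) > l * n}"

lemma bilinear_tail_set_measurable:
  assumes "mpt M T" and [measurable]: "f \<in> borel_measurable M" "g \<in> borel_measurable M"
  shows "bilinear_tail_set M T f g l I \<in> sets M"
proof -
  note [measurable] = mpt_funpow(1)[OF assms(1)]
  show ?thesis unfolding bilinear_tail_set_def by measurable
qed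

text \<open>The counting bound is applied to the values along the orbit of each \<open>x\<close> and
  integrated over \<open>x\<close>. Invariance makes every time contribute the same integral, so
  \<open>N * measure M A\<close> is bounded by \<open>N + 2 * R\<close> times a constant; dividing
  by \<open>N\<close> and letting \<open>N\<close> tend to infinity with \<open>R\<close> fixed
  removes the boundary term.\<close>

lemma measure_bilinear_tail_set_bounded:
  fixes p l :: real
  assumes "prob_space M" and T: "mpt M T" and p: "p > 1" and l: "l \<ge> 1"
    and f: "f \<in> borel_measurable M" "\<And>x. x \<in> space M \<Longrightarrow> f x \<ge> 0"
    and fp: "integrable M (\<lambda>x. f x powr p)" "(\<integral>x. f x powr p \<partial>M) \<le> 1"
    and g: "g \<in> borel_measurable M" "\<And>x. x \<in> space M \<Longrightarrow> g x \<ge> 0"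
    and g1: "integrable M g" "(\<integral>x. g x \<partial>M) \<le> 1"
  shows "measure M (bilinear_tail_set M T f g l {1..R})
    \<le> (2 + 4 / (1 - 2 powr (1 - p))) * sqrt (1 / l)"
proof -
  interpret prob_space M by fact
  define A where "A = bilinear_tail_set M T f g l {1..R}"
  define \<kappa> where "\<kappa> = 1 / (1 - 2 powr (1 - p))"
  \<comment> \<open>This choice balances the two contributions \<open>1 / t\<close> and
    \<open>t / l\<close>.\<close>
  define t where "t = sqrt l"
  have t: "t \<ge> 1" "l = t * t" using l by (auto simp: t_def)
  have \<kappa>: "\<kappa> \<ge> 0" using p powr_mono[of "1 - p" 0 "2::real"] by (auto simp: \<kappa>_def)
  have A[measurable]: "A \<in> sets M" unfolding A_def by (rule bilinear_tail_set_measurable) (use T f g in auto)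
  have Tsp: "(T ^^ i) x \<in> space M" if "x \<in> space M" for i x
    using mpt_funpow(1)[OF T] that by (rule measurable_space)
  have iA: "integrable M (indicator A :: 'a \<Rightarrow> real)"
    using A by (simp add: integrable_indicator_iff emeasure_eq_measure)
  have bound: "N * measure M A \<le> (N + 2 * R) * ((2 + 4 * \<kappa>) / t)" for N :: nat
  proof -
    have pt: "(\<Sum>j<N. indicator A ((T ^^ j) x))
        \<le> (\<Sum>i<N+2*R. f ((T ^^ i) x) powr p) / t + (1 + 4 * t * \<kappa>) / l * (\<Sum>i<N+2*R. g ((T ^^ i) x))"
      if x: "x \<in> space M" for x
    proof -
      have "(\<Sum>j<N. indicator A ((T ^^ j) x) :: real) = card ({..<N} \<inter> {j. (T ^^ j) x \<in> A})"
        by (simp add: indicator_def sum.If_cases)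
      also have "{..<N} \<inter> {j. (T ^^ j) x \<in> A} = {j. j < N \<and>
          (\<exists>n\<in>{1..R}. f ((T ^^ (j + n)) x) * g ((T ^^ (j + 2 * n)) x) > l * n)}"
      proof -
        have "(T ^^ n) ((T ^^ j) x) = (T ^^ (j + n)) x" for n j
          by (metis add.commute comp_apply funpow_add)
        then show ?thesis using Tsp[OF x] by (auto simp: A_def bilinear_tail_set_def)
      qed
      also have "card \<dots> \<le> (\<Sum>i<N+2*R. f ((T ^^ i) x) powr p) / t
          + (1 + 4 * t / (1 - 2 powr (1 - p))) / l * (\<Sum>i<N+2*R. g ((T ^^ i) x))"
        by (rule card_bilinear_gt_le) (use f g Tsp[OF x] t l p in auto)
      finally show ?thesis by (simp add: \<kappa>_def)
    qed
    note int = mpt_integral_funpow[OF T iA] mpt_integral_funpow[OF T fp(1)] mpt_integral_funpow[OF T g1(1)]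
    have "N * measure M A = (\<integral>x. (\<Sum>j<N. indicator A ((T ^^ j) x)) \<partial>M)"
      by (simp add: int)
    also have "\<dots> \<le> (\<integral>x. (\<Sum>i<N+2*R. f ((T ^^ i) x) powr p) / t
        + (1 + 4 * t * \<kappa>) / l * (\<Sum>i<N+2*R. g ((T ^^ i) x)) \<partial>M)"
      by (rule integral_mono) (use int pt in auto)
    also have "\<dots> = (N + 2 * R) * ((\<integral>x. f x powr p \<partial>M) / t + (1 + 4 * t * \<kappa>) / l * (\<integral>x. g x \<partial>M))"
      using int by (simp add: algebra_simps)
    \<comment> \<open>Here \<open>1 + 4 * t * \<kappa>\<close> is enlarged to
      \<open>t + 4 * t * \<kappa>\<close>, by \<open>t \<ge> 1\<close>, so that every term becomes a
      multiple of \<open>1 / t\<close>.\<close>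
    also have "\<dots> \<le> (N + 2 * R) * (1 / t + (t + 4 * t * \<kappa>) / l * 1)"
      using t l \<kappa> fp g1 g
      by (intro mult_left_mono add_mono divide_right_mono mult_mono) (auto intro!: integral_nonneg_AE)
    also have "1 / t + (t + 4 * t * \<kappa>) / l * 1 = (2 + 4 * \<kappa>) / t"
      using t by (simp add: field_simps)
    finally show ?thesis .
  qed
  have "measure M A \<le> (2 + 4 * \<kappa>) / t"
  proof (rule LIMSEQ_le[OF tendsto_const])
    have "(\<lambda>N. 1 + 2 * R / real N) \<longlonglongrightarrow> 1 + 0"
      by (intro tendsto_add tendsto_const lim_const_over_n)
    then show "(\<lambda>N. (1 + 2 * R / real N) * ((2 + 4 * \<kappa>) / t)) \<longlonglongrightarrow> (2 + 4 * \<kappa>) / t"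
      using tendsto_mult_right[of _ "1 + 0" _ "(2 + 4 * \<kappa>) / t"] by simp
    have "measure M A \<le> (1 + 2 * R / real N) * ((2 + 4 * \<kappa>) / t)" if "N \<ge> 1" for N :: nat
    proof -
      have "measure M A \<le> ((N + 2 * R) * ((2 + 4 * \<kappa>) / t)) / N"
        by (subst pos_le_divide_eq) (use bound[of N] that in \<open>simp_all add: mult.commute\<close>)
      also have "\<dots> = (1 + 2 * R / real N) * ((2 + 4 * \<kappa>) / t)"
        using that t by (simp add: field_simps)
      finally show ?thesis .
    qed
    then show "\<exists>N0. \<forall>N\<ge>N0. measure M A \<le> (1 + 2 * R / real N) * ((2 + 4 * \<kappa>) / t)" by blast
  qed
  then show ?thesis by (simp add: A_def \<kappa>_def t_def real_sqrt_divide)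
qed

section \<open>Unbounded times, small levels and general norms\<close>

text \<open>For \<open>l \<ge> 1\<close> the truncated sets increase to the full one, so continuity
  from below applies. For \<open>l < 1\<close> the right-hand side is at least 1, which bounds any
  probability.\<close>

lemma measure_bilinear_tail_set_normalized:
  fixes p l :: real
  assumes "prob_space M" and T: "mpt M T" and p: "p > 1" and l: "l > 0"
    and f: "f \<in> borel_measurable M" "\<And>x. x \<in> space M \<Longrightarrow> f x \<ge> 0"
    and fp: "integrable M (\<lambda>x. f x powr p)" "(\<integral>x. f x powr p \<partial>M) \<le> 1"
    and g: "g \<in> borel_measurable M" "\<And>x. x \<in> space M \<Longrightarrow> g x \<ge> 0"
    and g1: "integrable M g" "(\<integral>x. g x \<partial>M) \<le> 1"
  shows "measure M (bilinear_tail_set M T f g l {1..})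
    \<le> (2 + 4 / (1 - 2 powr (1 - p))) * sqrt (1 / l)"
proof (cases "l \<ge> 1")
  case True
  interpret prob_space M by fact
  define A where "A R = bilinear_tail_set M T f g l {1..R}" for R
  have "(\<lambda>R. measure M (A R)) \<longlonglongrightarrow> measure M (\<Union>R. A R)"
  proof (rule finite_Lim_measure_incseq)
    show "range A \<subseteq> sets M"
      using bilinear_tail_set_measurable[OF T f(1) g(1)] by (auto simp: A_def)
    show "incseq A" by (force simp: incseq_def A_def bilinear_tail_set_def)
  qed
  moreover have "(\<Union>R. A R) = bilinear_tail_set M T f g l {1..}"
    by (force simp: A_def bilinear_tail_set_def)
  moreover have "measure M (A R) \<le> (2 + 4 / (1 - 2 powr (1 - p))) * sqrt (1 / l)" for R
    unfolding A_def by (rule measure_bilinear_tail_set_bounded) (use assms True in auto)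
  ultimately show ?thesis by (metis LIMSEQ_le_const2)
next
  case False
  interpret prob_space M by fact
  have "2 + 4 / (1 - 2 powr (1 - p)) \<ge> 1"
    using p powr_mono[of "1 - p" 0 "2::real"] by (auto intro: add_increasing2)
  moreover have "sqrt (1 / l) \<ge> 1" using False l by (simp add: field_simps)
  ultimately have "1 * 1 \<le> (2 + 4 / (1 - 2 powr (1 - p))) * sqrt (1 / l)" by (intro mult_mono) auto
  then show ?thesis using prob_le_1[of "bilinear_tail_set M T f g l {1..}"] by linarith
qed

text \<open>Homogeneity: dividing \<open>f\<close> by \<open>a\<close> and \<open>g\<close> by
  \<open>b\<close> turns the level \<open>l\<close> into \<open>l / (a * b)\<close>. As a norm may
  be zero, each divisor is the norm plus some \<open>e > 0\<close>, and \<open>e\<close> tends to 0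
  at the end.\<close>

lemma measure_bilinear_tail_set_le:
  fixes p l :: real
  assumes "prob_space M" and T: "mpt M T" and p: "p > 1" and l: "l > 0"
    and f: "f \<in> borel_measurable M" "\<And>x. x \<in> space M \<Longrightarrow> f x \<ge> 0" "in_Lp M p f"
    and g: "g \<in> borel_measurable M" "\<And>x. x \<in> space M \<Longrightarrow> g x \<ge> 0" "in_Lp M 1 g"
  shows "measure M (bilinear_tail_set M T f g l {1..})
    \<le> (2 + 4 / (1 - 2 powr (1 - p))) * sqrt (Lp_norm M p f * Lp_norm M 1 g / l)"
proof -
  have fi: "integrable M (\<lambda>x. f x powr p)"
    using f by (auto simp: in_Lp_def cong: Bochner_Integration.integrable_cong)
  have gi: "integrable M g"
    using g by (auto simp: in_Lp_def cong: Bochner_Integration.integrable_cong)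
  have fN: "Lp_norm M p f = (\<integral>x. f x powr p \<partial>M) powr (1 / p)"
    using f by (auto simp: Lp_norm_def cong: Bochner_Integration.integral_cong)
  have gN: "Lp_norm M 1 g = (\<integral>x. g x \<partial>M)"
    using g by (auto simp: Lp_norm_def cong: Bochner_Integration.integral_cong)
  have gN0: "Lp_norm M 1 g \<ge> 0" unfolding gN using g by (auto intro!: integral_nonneg_AE)
  have fN0: "Lp_norm M p f \<ge> 0" by (simp add: Lp_norm_def)
  have fNp: "Lp_norm M p f powr p = (\<integral>x. f x powr p \<partial>M)"
    unfolding fN using p by (simp add: powr_powr)
  have le: "measure M (bilinear_tail_set M T f g l {1..})
      \<le> (2 + 4 / (1 - 2 powr (1 - p))) * sqrt ((Lp_norm M p f + e) * (Lp_norm M 1 g + e) / l)"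
    if e: "e > 0" for e
  proof -
    define a where "a = Lp_norm M p f + e"
    define b where "b = Lp_norm M 1 g + e"
    have a: "a > 0" and b: "b > 0" using e fN0 gN0 by (auto simp: a_def b_def)
    have scale: "l / (a * b) * n < x / a * (y / b) \<longleftrightarrow> l * n < x * y" for x y n :: real
      using a b by (simp add: field_simps)
    have "bilinear_tail_set M T f g l {1..}
        = bilinear_tail_set M T (\<lambda>x. f x / a) (\<lambda>x. g x / b) (l / (a * b)) {1..}"
      by (simp only: bilinear_tail_set_def scale)
    also have "measure M \<dots> \<le> (2 + 4 / (1 - 2 powr (1 - p))) * sqrt (1 / (l / (a * b)))"
    proof (rule measure_bilinear_tail_set_normalized)
      have pw: "(f x / a) powr p = f x powr p / a powr p" if "x \<in> space M" for x
        using a f that by (simp add: powr_divide)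
      show "integrable M (\<lambda>x. (f x / a) powr p)"
        using fi by (simp add: pw cong: Bochner_Integration.integrable_cong)
      have "(\<integral>x. (f x / a) powr p \<partial>M) = (\<integral>x. f x powr p \<partial>M) / a powr p"
        by (simp add: pw cong: Bochner_Integration.integral_cong)
      also have "\<dots> \<le> 1"
        unfolding fNp[symmetric] using a e p fN0
        by (simp add: a_def powr_mono2)
      finally show "(\<integral>x. (f x / a) powr p \<partial>M) \<le> 1" .
      show "(\<integral>x. g x / b \<partial>M) \<le> 1" using b e by (simp add: b_def gN)
    qed (use assms a b gi in auto)
    finally show ?thesis by (simp add: a_def b_def)
  qed
  show ?thesis
  proof (rule tendsto_lowerbound[where F = "at_right 0"])
    have "((\<lambda>e. (2 + 4 / (1 - 2 powr (1 - p))) * sqrt ((Lp_norm M p f + e) * (Lp_norm M 1 g + e) / l))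
      \<longlongrightarrow> (2 + 4 / (1 - 2 powr (1 - p))) * sqrt ((Lp_norm M p f + 0) * (Lp_norm M 1 g + 0) / l)) (at_right 0)"
      using l by (intro tendsto_intros) auto
    then show "((\<lambda>e. (2 + 4 / (1 - 2 powr (1 - p))) * sqrt ((Lp_norm M p f + e) * (Lp_norm M 1 g + e) / l))
      \<longlongrightarrow> (2 + 4 / (1 - 2 powr (1 - p))) * sqrt (Lp_norm M p f * Lp_norm M 1 g / l)) (at_right 0)"
      by simp
    show "\<forall>\<^sub>F e in at_right 0. measure M (bilinear_tail_set M T f g l {1..})
      \<le> (2 + 4 / (1 - 2 powr (1 - p))) * sqrt ((Lp_norm M p f + e) * (Lp_norm M 1 g + e) / l)"
      by (rule eventually_mono[OF eventually_at_right_less]) (rule le)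
  qed simp
qed

section \<open>Growth of the constant near \<open>p = 1\<close>, and the conclusion\<close>

lemma bilinear_constant_le:
  fixes p :: real
  assumes "1 < p" "p < 2"
  shows "2 + 4 / (1 - 2 powr (1 - p)) \<le> 10 / (p - 1)"
proof -
  define q where "q = p - 1"
  have q: "0 < q" "q < 1" using assms by (auto simp: q_def)
  \<comment> \<open>Weighted AM-GM at the points \<open>1/2\<close> and \<open>1\<close>: the convex
    function \<open>(1/2) powr q\<close> lies below its chord \<open>1 - q / 2\<close> on the unit
    interval. The constant 10 is then 8 from this bound plus 2 from
    \<open>2 \<le> 2 / q\<close>.\<close>
  have "(1/2) powr q * 1 powr (1 - q) \<le> q * (1/2) + (1 - q) * (1::real)"
    by (rule Youngs_inequality_0) (use q in auto)
  moreover have "2 powr (1 - p) = (1/2) powr q"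
    by (simp add: q_def powr_divide powr_minus_divide[symmetric])
  ultimately have "q / 2 \<le> 1 - 2 powr (1 - p)" by simp
  then have "4 / (1 - 2 powr (1 - p)) \<le> 4 / (q / 2)" using q by (intro divide_left_mono) auto
  moreover have "2 \<le> 2 / q" using q by (simp add: field_simps)
  ultimately show ?thesis unfolding q_def[symmetric] by simp
qed

theorem theorem1:
  fixes M :: "'a measure" and T :: "'a \<Rightarrow> 'a"
  assumes "prob_space M"
    and "ergodic M T"
    and "nonatomic M"
  shows "\<exists>(C :: real \<Rightarrow> real) (Ct :: real).
     (\<forall>p > 1. 
        (\<forall>f g (l::real).
           f \<in> borel_measurable M \<longrightarrow> (\<forall>x\<in>space M. f x \<ge> 0) \<longrightarrow> in_Lp M p f \<longrightarrow>
           g \<in> borel_measurable M \<longrightarrow> (\<forall>x\<in>space M. g x \<ge> 0) \<longrightarrow> in_Lp M 1 g \<longrightarrow>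
           l > 0 \<longrightarrow>
           measure M {x \<in> space M.
               (SUP n\<in>{1::nat..}. ereal (f ((T ^^ n) x) * g ((T ^^ (2 * n)) x) / real n))
                 > ereal l}
             \<le> C p * sqrt (Lp_norm M p f * Lp_norm M 1 g / l)))
     \<and> (\<forall>p. 1 < p \<and> p < 2 \<longrightarrow> C p \<le> Ct / (p - 1))"
proof -
  have T: "mpt M T" using assms(2) by (simp add: ergodic_def)
  \<comment> \<open>A supremum exceeds \<open>l\<close> strictly exactly when one of its terms does,
    so no attainment is required.\<close>
  have set_eq: "{x \<in> space M.
      (SUP n\<in>{1::nat..}. ereal (f ((T ^^ n) x) * g ((T ^^ (2 * n)) x) / real n)) > ereal l}
    = bilinear_tail_set M T f g l {1..}" for f g l
    by (auto simp: bilinear_tail_set_def less_SUP_iff field_simps)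
  show ?thesis
    unfolding set_eq
    by (rule exI[of _ "\<lambda>p. 2 + 4 / (1 - 2 powr (1 - p))"], rule exI[of _ 10])
      (use measure_bilinear_tail_set_le[OF assms(1) T] bilinear_constant_le in blast)
qed

end
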